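(* Let $(\mathcal{X},\mathcal{D})$ be a complete metric space and let $f:\mathcal{X}\to\mathcal{X}$ be a self map such that $\mathcal{D}_f(x)<\infty$ for every $x\in\mathcal{X}$. Suppose that $f$ is a generalized contraction of type (II), i.e. there exist $\phi\in\Phi$ and real numbers $\alpha,\beta,\gamma,\delta\geq 0$ with $\alpha+\beta+\gamma+\delta\leq 1$ such that $$\mathcal{D}(fx,fy)\leq \alpha\,\phi(\mathcal{D}_{f}(x))+\beta\,\phi(\mathcal{D}_{f}(y))+\gamma\,\phi(\mathcal{D}_{f}(x,y))+\delta\,\phi(M_{f}(x,y))$$ for all $x,y\in\mathcal{X}$. Then $f$ has a unique fixed point. Moreover, for each $x\in\mathcal{X}$, the sequence $(f^{n}x)$ converges to the fixed point of $f$.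
   Context: For a self map $f$ on a metric space $(\mathcal{X},\mathcal{D})$: $O_f(x)=\{x,fx,f^2x,\dots\}$ is the set of iterates of $f$ at $x$; $\mathcal{D}_f(x)=\sup\{\mathcal{D}(u,v):u,v\in O_f(x)\}$; $\mathcal{D}_f(x,y)=\sup\{\mathcal{D}(u,v):u,v\in O_f(x)\cup O_f(y)\}$; $M_f(x,y)=\frac{\mathcal{D}_f(x)+\mathcal{D}_f(y)}{2}$. It is assumed throughout that $\mathcal{D}_f(x)$ is finite for each $x\in\mathcal{X}$. $\Phi$ is the collection of all functions $\phi:[0,\infty)\to[0,\infty)$ such that (1) $\phi(t)<t$ for each $t>0$; and (2) for each $\epsilon>0$ there exists $\mathfrak{d}>0$ such that $\phi(t)\leq\epsilon$ for every $t\in(\epsilon,\epsilon+\mathfrak{d})$.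
   Formalization: The formal theorem also assumes φ(0)=0, which Φ does not require; without it the claim fails: the identity on two points at distance 1 with φ(0)=1, φ(t)=t/2 for t>0, α=1, β=γ=δ=0 satisfies every hypothesis but has two fixed points. *)

theory Defs
  imports "HOL-Analysis.Analysis"
begin

definition iterates :: "('a \<Rightarrow> 'a) \<Rightarrow> 'a \<Rightarrow> 'a set" where
  "iterates f x = range (\<lambda>n. (f ^^ n) x)"

(* On a nonempty set, the library's diameter is the supremum of the pairwise distances
   as a real number. It is only meaningful if those distances are bounded above, which is
   what finite_orbit_diam expresses. Then the union of two orbits also has bounded
   distances. *)

definition orbit_diam :: "('a::metric_space \<Rightarrow> 'a) \<Rightarrow> 'a \<Rightarrow> real" where
  "orbit_diam f x = diameter (iterates f x)"

definition orbit_diam2 :: "('a::metric_space \<Rightarrow> 'a) \<Rightarrow> 'a \<Rightarrow> 'a \<Rightarrow> real" where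
  "orbit_diam2 f x y = diameter (iterates f x \<union> iterates f y)"

definition orbit_mean :: "('a::metric_space \<Rightarrow> 'a) \<Rightarrow> 'a \<Rightarrow> 'a \<Rightarrow> real" where
  "orbit_mean f x y = (orbit_diam f x + orbit_diam f y) / 2"

definition finite_orbit_diam :: "('a::metric_space \<Rightarrow> 'a) \<Rightarrow> 'a \<Rightarrow> bool" where
  "finite_orbit_diam f x \<longleftrightarrow>
     bdd_above {dist u v | u v. u \<in> iterates f x \<and> v \<in> iterates f x}"

(* Functions from [0,oo) to [0,oo) are represented by total functions on the reals whose
   values at negative arguments are irrelevant. Membership does not constrain the value
   at 0 beyond nonnegativity. *)

definition Phi :: "(real \<Rightarrow> real) set" where
  "Phi = {\<phi>. (\<forall>t\<ge>0. \<phi> t \<ge> 0) \<and> (\<forall>t>0. \<phi> t < t) \<and>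
              (\<forall>\<epsilon>>0. \<exists>d>0. \<forall>t\<in>{\<epsilon><..<\<epsilon> + d}. \<phi> t \<le> \<epsilon>)}"

(* The control function is an argument, so that a value at 0 can be imposed on it
   separately. If it may be positive at 0, fixed points need not be unique: the identity on
   two points at distance 1 satisfies the inequality with coefficients 1, 0, 0, 0 and the
   control function in Phi that is 1 at 0 and t / 2 at t > 0. *)

definition gen_contraction_II :: "(real \<Rightarrow> real) \<Rightarrow> ('a::metric_space \<Rightarrow> 'a) \<Rightarrow> bool" where
  "gen_contraction_II \<phi> f \<longleftrightarrow>
     (\<exists>\<alpha> \<beta> \<gamma> \<delta> :: real. \<alpha> \<ge> 0 \<and> \<beta> \<ge> 0 \<and> \<gamma> \<ge> 0 \<and> \<delta> \<ge> 0 \<and> \<alpha> + \<beta> + \<gamma> + \<delta> \<le> 1 \<and>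
       (\<forall>x y. dist (f x) (f y) \<le>
          \<alpha> * \<phi> (orbit_diam f x) + \<beta> * \<phi> (orbit_diam f y)
          + \<gamma> * \<phi> (orbit_diam2 f x y) + \<delta> * \<phi> (orbit_mean f x y)))"

end

theory Submission
  imports Defs
begin

text \<open>
  All quantities on the right-hand side of the contraction inequality are joint orbit diameters
  \<open>orbit_diam2\<close>, or means of two of them, because \<open>orbit_diam f x = orbit_diam2 f x x\<close>.
  Such a diameter can only shrink when its two points move forward along their orbits. So the
  whole proof follows \<open>c n = orbit_diam2 f (f\<^sup>n x) (f\<^sup>n y)\<close> for two arbitrary points.

  Two facts force \<open>c n\<close> to tend to \<open>0\<close>. First, if \<open>c n\<close> lies just above a number \<open>\<epsilon> > 0\<close>,
  then \<open>\<phi>\<close> is at most \<open>\<epsilon>\<close> at every relevant argument, so \<open>c (n + 1) \<le> \<epsilon>\<close>. Hence a positive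
  limit would be attained. Second, a positive value strictly decreases in one step
  (\<open>orbit_diam2_step_less\<close>). The inequality \<open>\<phi> t < t\<close> alone does not give this, since \<open>c (n + 1)\<close>
  is a supremum over infinitely many pairs and \<open>\<phi> t\<close> may approach \<open>D\<close> as \<open>t\<close> increases
  to \<open>D = c n\<close>. However, the arguments that occur cannot approach \<open>D\<close> strictly from below:
  they are indexed antitonically by pairs of naturals, and by Dickson's lemma there are no
  strictly increasing infinite sequences among them (\<open>gap_below_antimono2\<close>).

  Taking \<open>x = y\<close>, every orbit is Cauchy. Taking for \<open>y\<close> the limit \<open>z\<close> of the orbit of \<open>x\<close>, the
  orbit of \<open>z\<close> also tends to \<open>z\<close>. Although \<open>f\<close> need not be continuous, this means that dropping
  \<open>z\<close> from its own orbit does not change the diameter, which by strict decrease must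
  then be \<open>0\<close>; so \<open>z\<close> is fixed. Uniqueness, and convergence of all orbits to the fixed point,
  are \<open>c n \<longlonglongrightarrow> 0\<close> again.
\<close>

section \<open>Gaps below a bound\<close>

lemma gap_below_antimono:
  fixes h :: "nat \<Rightarrow> real"
  assumes "antimono h"
  shows "\<exists>s<D. \<forall>n. h n < D \<longrightarrow> h n \<le> s"
proof (cases "\<exists>n. h n < D")
  case True
  \<comment> \<open>The first value below \<open>D\<close> bounds all others below \<open>D\<close>.\<close>
  define k where "k = (LEAST n. h n < D)"
  have "h k < D" using True unfolding k_def by (rule LeastI_ex)
  moreover have "h n \<le> h k" if "h n < D" for n
    using that assms by (simp add: antimonoD k_def Least_le)
  ultimately show ?thesis by blast
next
  case False
  then show ?thesis by (intro exI[of _ "D - 1"]) auto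
qed

text \<open>If \<open>h i0 j0 < D\<close>, then \<open>h i0 j0\<close> bounds the values with \<open>i \<ge> i0\<close> and \<open>j \<ge> j0\<close>; all others lie
  in finitely many rows and columns, each of which has its own gap.\<close>

lemma gap_below_antimono2:
  fixes h :: "nat \<Rightarrow> nat \<Rightarrow> real"
  assumes h: "\<And>i j i' j'. i \<le> i' \<Longrightarrow> j \<le> j' \<Longrightarrow> h i' j' \<le> h i j"
  shows "\<exists>s<D. \<forall>i j. h i j < D \<longrightarrow> h i j \<le> s"
proof (cases "\<exists>i j. h i j < D")
  case True
  then obtain i0 j0 where ij0: "h i0 j0 < D" by blast
  have "\<forall>i. \<exists>s<D. \<forall>j. h i j < D \<longrightarrow> h i j \<le> s"
    by (intro allI gap_below_antimono) (auto intro!: antimonoI h)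
  then obtain r where r: "\<And>i. r i < D" "\<And>i j. h i j < D \<Longrightarrow> h i j \<le> r i" by metis
  have "\<forall>j. \<exists>s<D. \<forall>i. h i j < D \<longrightarrow> h i j \<le> s"
    by (intro allI gap_below_antimono) (auto intro!: antimonoI h)
  then obtain c where c: "\<And>j. c j < D" "\<And>i j. h i j < D \<Longrightarrow> h i j \<le> c j" by metis
  define B where "B = insert (h i0 j0) (r ` {..<i0} \<union> c ` {..<j0})"
  have B: "finite B" "B \<noteq> {}" by (auto simp: B_def)
  have "Max B < D" using B r(1) c(1) ij0 by (auto simp: B_def)
  moreover have "h i j \<le> Max B" if lt: "h i j < D" for i j
  proof -
    have "\<exists>b\<in>B. h i j \<le> b"
    proof (cases "i < i0 \<or> j < j0")
      case True
      then show ?thesis using r(2)[OF lt] c(2)[OF lt] by (auto simp: B_def)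
    next
      case False
      then show ?thesis using h[of i0 i j0 j] by (auto simp: B_def)
    qed
    then show ?thesis using B Max_ge order_trans by blast
  qed
  ultimately show ?thesis by blast
next
  case False
  then show ?thesis by (intro exI[of _ "D - 1"]) auto
qed

section \<open>Joint orbit diameters\<close>

lemma funpow_in_iterates: "(f ^^ n) x \<in> iterates f x"
  by (simp add: iterates_def)

lemma funpow_in_iterates_funpow:
  assumes "k \<le> n"
  shows "(f ^^ n) x \<in> iterates f ((f ^^ k) x)"
proof -
  have "(f ^^ n) x = (f ^^ (n - k)) ((f ^^ k) x)"
    using assms funpow_add[of "n - k" k f] by simp
  then show ?thesis by (simp add: funpow_in_iterates)
qed

lemma self_in_iterates: "x \<in> iterates f x"
  using funpow_in_iterates[of 0] by simp

lemma iterates_subset: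
  assumes "u \<in> iterates f x"
  shows "iterates f u \<subseteq> iterates f x"
proof -
  obtain n where "u = (f ^^ n) x" using assms by (auto simp: iterates_def)
  then have "(f ^^ m) u = (f ^^ (m + n)) x" for m by (simp add: funpow_add)
  then show ?thesis by (auto simp: iterates_def)
qed

lemma iterates_step: "iterates f (f x) = f ` iterates f x"
  by (auto simp: iterates_def image_image funpow_swap1)

lemma iterates_eq_insert: "iterates f x = insert x (iterates f (f x))"
proof
  show "iterates f x \<subseteq> insert x (iterates f (f x))"
  proof
    fix u assume "u \<in> iterates f x"
    then obtain n where "u = (f ^^ n) x" by (auto simp: iterates_def)
    then show "u \<in> insert x (iterates f (f x))"
      by (cases n) (auto simp: iterates_def funpow_swap1)
  qed
  show "insert x (iterates f (f x)) \<subseteq> iterates f x"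
    using iterates_subset[of "f x" f x] self_in_iterates[of x f] funpow_in_iterates[of 1 f x]
    by simp
qed

lemma bounded_iterates:
  assumes "finite_orbit_diam f x"
  shows "bounded (iterates f x)"
proof -
  obtain M where "\<And>u v. u \<in> iterates f x \<Longrightarrow> v \<in> iterates f x \<Longrightarrow> dist u v \<le> M"
    using assms by (auto simp: finite_orbit_diam_def bdd_above_def)
  then show ?thesis unfolding bounded_def using self_in_iterates by blast
qed

lemma orbit_diam_eq: "orbit_diam f x = orbit_diam2 f x x"
  by (simp add: orbit_diam_def orbit_diam2_def)

lemma diameter_le_metric:
  fixes S :: "'a::metric_space set"
  assumes "S \<noteq> {}" "\<And>u v. u \<in> S \<Longrightarrow> v \<in> S \<Longrightarrow> dist u v \<le> M"
  shows "diameter S \<le> M"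
  unfolding diameter_def using assms by (auto intro!: cSUP_least)

section \<open>Shrinking of joint orbits\<close>

locale bounded_gen_contraction =
  fixes f :: "'a::metric_space \<Rightarrow> 'a" and \<phi> :: "real \<Rightarrow> real" and \<alpha> \<beta> \<gamma> \<delta> :: real
  assumes finite_diam: "finite_orbit_diam f x"
    and Phi: "\<phi> \<in> Phi" and phi_0: "\<phi> 0 = 0"
    and coeffs: "\<alpha> \<ge> 0" "\<beta> \<ge> 0" "\<gamma> \<ge> 0" "\<delta> \<ge> 0" "\<alpha> + \<beta> + \<gamma> + \<delta> \<le> 1"
    and contraction: "dist (f x) (f y) \<le> \<alpha> * \<phi> (orbit_diam f x) + \<beta> * \<phi> (orbit_diam f y)
          + \<gamma> * \<phi> (orbit_diam2 f x y) + \<delta> * \<phi> (orbit_mean f x y)"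
begin

lemma phi_nonneg: "t \<ge> 0 \<Longrightarrow> \<phi> t \<ge> 0"
  and phi_less: "t > 0 \<Longrightarrow> \<phi> t < t"
  using Phi unfolding Phi_def by blast+

lemma phi_le: "t \<ge> 0 \<Longrightarrow> \<phi> t \<le> t"
  using phi_less[of t] phi_0 by (cases "t = 0") auto

lemma phi_le_eps:
  assumes "\<epsilon> > 0"
  shows "\<exists>d>0. \<forall>t. 0 \<le> t \<longrightarrow> t < \<epsilon> + d \<longrightarrow> \<phi> t \<le> \<epsilon>"
proof -
  obtain d where d: "d > 0" "\<forall>t\<in>{\<epsilon><..<\<epsilon> + d}. \<phi> t \<le> \<epsilon>"
    using Phi assms unfolding Phi_def by blast
  have "\<phi> t \<le> \<epsilon>" if "0 \<le> t" "t < \<epsilon> + d" for t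
    using that d(2) phi_le[of t] by (cases "t \<le> \<epsilon>") auto
  with d(1) show ?thesis by blast
qed

lemma bounded_union: "bounded (iterates f x \<union> iterates f y)"
  using bounded_iterates[OF finite_diam] by simp

lemma dist_le_orbit_diam2:
  assumes "u \<in> iterates f x \<union> iterates f y" "v \<in> iterates f x \<union> iterates f y"
  shows "dist u v \<le> orbit_diam2 f x y"
  unfolding orbit_diam2_def using diameter_bounded_bound[OF bounded_union] assms by blast

lemma orbit_diam2_nonneg: "orbit_diam2 f x y \<ge> 0"
  unfolding orbit_diam2_def by (rule diameter_ge_0[OF bounded_union])

lemma orbit_diam2_mono:
  assumes "u \<in> iterates f x \<union> iterates f y" "v \<in> iterates f x \<union> iterates f y"
  shows "orbit_diam2 f u v \<le> orbit_diam2 f x y"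
proof -
  have "iterates f u \<union> iterates f v \<subseteq> iterates f x \<union> iterates f y"
    using assms iterates_subset[of u f] iterates_subset[of v f] by blast
  then show ?thesis
    unfolding orbit_diam2_def by (rule diameter_subset[OF _ bounded_union])
qed

lemma orbit_diam2_funpow_mono:
  assumes "i \<le> i'" "j \<le> j'"
  shows "orbit_diam2 f ((f ^^ i') x) ((f ^^ j') y) \<le> orbit_diam2 f ((f ^^ i) x) ((f ^^ j) y)"
  using assms by (intro orbit_diam2_mono) (auto intro: funpow_in_iterates_funpow)

lemma orbit_diam2_step_le:
  assumes "\<And>u v. u \<in> iterates f x \<union> iterates f y \<Longrightarrow> v \<in> iterates f x \<union> iterates f y \<Longrightarrow>
             dist (f u) (f v) \<le> M"
  shows "orbit_diam2 f (f x) (f y) \<le> M"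
  unfolding orbit_diam2_def iterates_step image_Un[symmetric]
  using assms self_in_iterates[of x f] by (intro diameter_le_metric) auto

text \<open>The coefficients sum to at most \<open>1\<close>, so the right-hand side of the contraction inequality
  is at most a common bound of the values of \<open>\<phi>\<close> that occur in it.\<close>

lemma dist_step_le:
  assumes "M \<ge> 0"
    and "\<phi> (orbit_diam2 f u u) \<le> M" "\<phi> (orbit_diam2 f v v) \<le> M" "\<phi> (orbit_diam2 f u v) \<le> M"
      "\<phi> ((orbit_diam2 f u u + orbit_diam2 f v v) / 2) \<le> M"
  shows "dist (f u) (f v) \<le> M"
proof -
  have "dist (f u) (f v) \<le> \<alpha> * M + \<beta> * M + \<gamma> * M + \<delta> * M"
    using contraction[of u v] assms coeffs
    unfolding orbit_mean_def orbit_diam_eq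
    by (elim order_trans) (intro add_mono mult_left_mono; assumption)
  also have "\<dots> = (\<alpha> + \<beta> + \<gamma> + \<delta>) * M" by (simp add: algebra_simps)
  also have "\<dots> \<le> 1 * M" using coeffs assms(1) by (intro mult_right_mono) auto
  finally show ?thesis by simp
qed

text \<open>Applied to each of the four pairs of starting points, the gap below an antitone family shows
  that the diameters on the right-hand side of the contraction inequality cannot approach that of
  the joint orbit without reaching it.\<close>

lemma orbit_diam2_gap:
  "\<exists>s<D. \<forall>u \<in> iterates f x \<union> iterates f y. \<forall>v \<in> iterates f x \<union> iterates f y.
     orbit_diam2 f u v < D \<longrightarrow> orbit_diam2 f u v \<le> s"
proof -
  have "\<forall>p q. \<exists>s<D. \<forall>i j. orbit_diam2 f ((f ^^ i) p) ((f ^^ j) q) < D \<longrightarrow>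
            orbit_diam2 f ((f ^^ i) p) ((f ^^ j) q) \<le> s"
    by (intro allI gap_below_antimono2 orbit_diam2_funpow_mono)
  then obtain s where s: "\<And>p q. s p q < D"
    "\<And>p q i j. orbit_diam2 f ((f ^^ i) p) ((f ^^ j) q) < D \<Longrightarrow>
            orbit_diam2 f ((f ^^ i) p) ((f ^^ j) q) \<le> s p q" by metis
  define m where "m = Max ((\<lambda>(p, q). s p q) ` ({x, y} \<times> {x, y}))"
  have "m < D" using s(1) by (auto simp: m_def)
  moreover have "orbit_diam2 f u v \<le> m"
    if uv: "u \<in> iterates f x \<union> iterates f y" "v \<in> iterates f x \<union> iterates f y"
      and lt: "orbit_diam2 f u v < D" for u v
  proof -
    obtain p i where p: "p \<in> {x, y}" "u = (f ^^ i) p" using uv(1) by (auto simp: iterates_def)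
    obtain q j where q: "q \<in> {x, y}" "v = (f ^^ j) q" using uv(2) by (auto simp: iterates_def)
    have "orbit_diam2 f u v \<le> s p q" using s(2) lt p q by simp
    also have "s p q \<le> m" unfolding m_def using p(1) q(1) by (intro Max_ge) auto
    finally show ?thesis .
  qed
  ultimately show ?thesis by blast
qed

text \<open>Every diameter on the right-hand side is either equal to \<open>D\<close>, where \<open>\<phi> D < D\<close>, or at most
  \<open>s < D\<close>; a mean of two of them is then equal to \<open>D\<close> or at most \<open>(D + s) / 2\<close>.\<close>

lemma orbit_diam2_step_less:
  assumes pos: "orbit_diam2 f x y > 0"
  shows "orbit_diam2 f (f x) (f y) < orbit_diam2 f x y"
proof -
  define D where "D = orbit_diam2 f x y"
  let ?U = "iterates f x \<union> iterates f y"
  obtain s where s: "s < D"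
    "\<And>u v. u \<in> ?U \<Longrightarrow> v \<in> ?U \<Longrightarrow> orbit_diam2 f u v < D \<Longrightarrow> orbit_diam2 f u v \<le> s"
    using orbit_diam2_gap[of D x y] by blast
  define M where "M = max (\<phi> D) ((D + s) / 2)"
  have "M < D" using phi_less pos s(1) by (auto simp: M_def D_def)
  have "M \<ge> 0" using phi_nonneg[of D] pos by (auto simp: M_def D_def)
  have phi_M: "\<phi> t \<le> M" if "0 \<le> t" "t = D \<or> t \<le> (D + s) / 2" for t
    using that phi_le[of t] unfolding M_def by (auto intro: max.coboundedI2)
  have diam: "orbit_diam2 f u v = D \<or> orbit_diam2 f u v \<le> s" if "u \<in> ?U" "v \<in> ?U" for u v
    using s(2)[OF that] orbit_diam2_mono[OF that] unfolding D_def by linarith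
  have "dist (f u) (f v) \<le> M" if uv: "u \<in> ?U" "v \<in> ?U" for u v
  proof (rule dist_step_le)
    show "\<phi> (orbit_diam2 f u u) \<le> M" "\<phi> (orbit_diam2 f v v) \<le> M" "\<phi> (orbit_diam2 f u v) \<le> M"
      using diam[of u u] diam[of v v] diam[of u v] uv s(1)
      by (auto intro!: phi_M orbit_diam2_nonneg)
    show "\<phi> ((orbit_diam2 f u u + orbit_diam2 f v v) / 2) \<le> M"
      using diam[of u u] diam[of v v] uv s(1) orbit_diam2_nonneg[of u u] orbit_diam2_nonneg[of v v]
      by (intro phi_M) auto
  qed fact
  then have "orbit_diam2 f (f x) (f y) \<le> M" by (rule orbit_diam2_step_le)
  with \<open>M < D\<close> show ?thesis by (simp add: D_def)
qed

lemma orbit_diam2_step_le_eps: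
  assumes \<phi>: "\<And>t. 0 \<le> t \<Longrightarrow> t < b \<Longrightarrow> \<phi> t \<le> \<epsilon>" and "\<epsilon> > 0" and lt: "orbit_diam2 f x y < b"
  shows "orbit_diam2 f (f x) (f y) \<le> \<epsilon>"
proof (rule orbit_diam2_step_le, rule dist_step_le)
  fix u v assume uv: "u \<in> iterates f x \<union> iterates f y" "v \<in> iterates f x \<union> iterates f y"
  have b: "orbit_diam2 f u u < b" "orbit_diam2 f v v < b" "orbit_diam2 f u v < b"
    using orbit_diam2_mono[OF uv(1) uv(1)] orbit_diam2_mono[OF uv(2) uv(2)]
      orbit_diam2_mono[OF uv] lt by linarith+
  then show "\<phi> (orbit_diam2 f u u) \<le> \<epsilon>" "\<phi> (orbit_diam2 f v v) \<le> \<epsilon>" "\<phi> (orbit_diam2 f u v) \<le> \<epsilon>"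
    by (simp_all add: \<phi> orbit_diam2_nonneg)
  show "\<phi> ((orbit_diam2 f u u + orbit_diam2 f v v) / 2) \<le> \<epsilon>"
    using b orbit_diam2_nonneg[of u u] orbit_diam2_nonneg[of v v] by (intro \<phi>) auto
qed (use \<open>\<epsilon> > 0\<close> in simp)

text \<open>A positive limit \<open>\<epsilon>\<close> would be reached one step after the diameter gets close enough to it,
  and the strict decrease in the following step would go below it.\<close>

lemma orbit_diam2_tendsto_0:
  "(\<lambda>n. orbit_diam2 f ((f ^^ n) x) ((f ^^ n) y)) \<longlonglongrightarrow> 0"
proof -
  define c where "c = (\<lambda>n. orbit_diam2 f ((f ^^ n) x) ((f ^^ n) y))"
  have "decseq c"
    unfolding c_def by (intro decseq_SucI orbit_diam2_funpow_mono) auto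
  moreover have nonneg: "0 \<le> c n" for n
    unfolding c_def by (rule orbit_diam2_nonneg)
  ultimately obtain \<epsilon> where lim: "c \<longlonglongrightarrow> \<epsilon>" and ge: "\<And>n. \<epsilon> \<le> c n"
    using decseq_convergent[of c 0] by blast
  have "\<epsilon> \<le> 0"
  proof (rule ccontr)
    assume "\<not> \<epsilon> \<le> 0"
    then have "\<epsilon> > 0" by simp
    then obtain d where d: "d > 0" "\<And>t. 0 \<le> t \<Longrightarrow> t < \<epsilon> + d \<Longrightarrow> \<phi> t \<le> \<epsilon>"
      using phi_le_eps by blast
    have "eventually (\<lambda>n. c n < \<epsilon> + d) sequentially"
      using lim d(1) by (intro order_tendstoD(2)) auto
    then obtain N where "c N < \<epsilon> + d" by (auto simp: eventually_sequentially)
    then have "c (Suc N) \<le> \<epsilon>"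
      using orbit_diam2_step_le_eps[OF d(2) \<open>\<epsilon> > 0\<close>] by (simp add: c_def)
    moreover have "c (Suc (Suc N)) < c (Suc N)"
      using orbit_diam2_step_less[of "(f ^^ Suc N) x" "(f ^^ Suc N) y"] ge[of "Suc N"] \<open>\<epsilon> > 0\<close>
      by (simp add: c_def)
    ultimately show False using ge[of "Suc (Suc N)"] by linarith
  qed
  moreover have "\<epsilon> \<ge> 0"
    using lim by (rule LIMSEQ_le_const) (simp add: nonneg)
  ultimately show ?thesis using lim by (simp add: c_def)
qed

section \<open>The fixed point\<close>

lemma dist_funpow_tendsto_0: "(\<lambda>n. dist ((f ^^ n) x) ((f ^^ n) y)) \<longlonglongrightarrow> 0"
  by (rule tendsto_sandwich[OF _ _ tendsto_const orbit_diam2_tendsto_0[of x y]])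
    (auto intro!: always_eventually dist_le_orbit_diam2 simp: self_in_iterates)

lemma funpow_tendsto_transfer:
  assumes "(\<lambda>n. (f ^^ n) x) \<longlonglongrightarrow> z"
  shows "(\<lambda>n. (f ^^ n) y) \<longlonglongrightarrow> z"
  unfolding tendsto_dist_iff[of _ z]
proof (rule tendsto_sandwich[OF _ _ tendsto_const])
  show "(\<lambda>n. dist ((f ^^ n) y) ((f ^^ n) x) + dist ((f ^^ n) x) z) \<longlonglongrightarrow> 0"
    using tendsto_add[OF dist_funpow_tendsto_0[of y x] assms[unfolded tendsto_dist_iff[of _ z]]]
    by simp
qed (simp_all add: dist_triangle)

lemma Cauchy_funpow: "Cauchy (\<lambda>n. (f ^^ n) x)"
proof (rule metric_CauchyI)
  fix e :: real assume "e > 0"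
  then have "eventually (\<lambda>n. orbit_diam2 f ((f ^^ n) x) ((f ^^ n) x) < e) sequentially"
    by (rule order_tendstoD(2)[OF orbit_diam2_tendsto_0])
  then obtain N where N: "orbit_diam2 f ((f ^^ N) x) ((f ^^ N) x) < e"
    by (auto simp: eventually_sequentially)
  have "dist ((f ^^ m) x) ((f ^^ n) x) < e" if "m \<ge> N" "n \<ge> N" for m n
    using that
    by (intro le_less_trans[OF dist_le_orbit_diam2 N]) (auto intro: funpow_in_iterates_funpow)
  then show "\<exists>N. \<forall>m\<ge>N. \<forall>n\<ge>N. dist ((f ^^ m) x) ((f ^^ n) x) < e" by blast
qed

text \<open>The point \<open>z\<close> is a limit of later points of its orbit, so the orbit of \<open>f z\<close> has the same
  diameter as that of \<open>z\<close>. A positive diameter would strictly decrease.\<close>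

lemma recurrent_imp_fixed:
  assumes lim: "(\<lambda>n. (f ^^ n) z) \<longlonglongrightarrow> z"
  shows "f z = z"
proof -
  let ?D1 = "orbit_diam2 f (f z) (f z)"
  have lim': "(\<lambda>n. (f ^^ n) (f z)) \<longlonglongrightarrow> z"
    using LIMSEQ_Suc[OF lim] by (simp add: funpow_swap1)
  have z: "dist z v \<le> ?D1" if "v \<in> iterates f (f z)" for v
  proof (rule LIMSEQ_le_const2)
    show "(\<lambda>n. dist ((f ^^ n) (f z)) v) \<longlonglongrightarrow> dist z v"
      by (intro tendsto_intros lim')
    show "\<exists>N. \<forall>n\<ge>N. dist ((f ^^ n) (f z)) v \<le> ?D1"
      using that funpow_in_iterates by (intro exI allI impI dist_le_orbit_diam2) auto
  qed
  have "orbit_diam2 f z z \<le> ?D1"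
    unfolding orbit_diam2_def[of f z z]
  proof (rule diameter_le_metric)
    fix u v assume "u \<in> iterates f z \<union> iterates f z" "v \<in> iterates f z \<union> iterates f z"
    then consider "u = z" "v = z" | "u = z" "v \<in> iterates f (f z)"
      | "u \<in> iterates f (f z)" "v = z" | "u \<in> iterates f (f z)" "v \<in> iterates f (f z)"
      unfolding iterates_eq_insert[of f z] by blast
    then show "dist u v \<le> ?D1"
    proof cases
      case 1
      then show ?thesis by (simp add: orbit_diam2_nonneg)
    next
      case 2
      then show ?thesis using z by blast
    next
      case 3
      then show ?thesis using z[of u] by (simp add: dist_commute[of u z])
    next
      case 4
      then show ?thesis by (intro dist_le_orbit_diam2) auto
    qed
  qed (use self_in_iterates[of z f] in blast)
  then have "orbit_diam2 f z z \<le> 0"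
    using orbit_diam2_step_less[of z z] by (meson leD leI)
  moreover have "dist (f z) z \<le> orbit_diam2 f z z"
    using self_in_iterates[of z f] funpow_in_iterates[of 1 f z]
    by (intro dist_le_orbit_diam2) auto
  ultimately show ?thesis
    by (metis dist_le_zero_iff order_trans)
qed

lemma funpow_tendsto_fixed:
  assumes "f z = z"
  shows "(\<lambda>n. (f ^^ n) x) \<longlonglongrightarrow> z"
proof (rule funpow_tendsto_transfer)
  have "(f ^^ n) z = z" for n using assms by (induction n) simp_all
  then show "(\<lambda>n. (f ^^ n) z) \<longlonglongrightarrow> z" by simp
qed

end

theorem theorem9:
  fixes f :: "'a::complete_space \<Rightarrow> 'a"
  assumes "\<forall>x. finite_orbit_diam f x"
    and "\<exists>\<phi>\<in>Phi. \<phi> 0 = 0 \<and> gen_contraction_II \<phi> f"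
  shows "(\<exists>!z. f z = z) \<and> (\<forall>x z. f z = z \<longrightarrow> (\<lambda>n. (f ^^ n) x) \<longlonglongrightarrow> z)"
proof -
  obtain \<phi> where \<phi>: "\<phi> \<in> Phi" "\<phi> 0 = 0" "gen_contraction_II \<phi> f"
    using assms(2) by blast
  obtain \<alpha> \<beta> \<gamma> \<delta> where "bounded_gen_contraction f \<phi> \<alpha> \<beta> \<gamma> \<delta>"
    using \<phi>(3) assms(1) \<phi>(1,2) unfolding gen_contraction_II_def bounded_gen_contraction_def
    by (elim exE conjE) blast
  then interpret bounded_gen_contraction f \<phi> \<alpha> \<beta> \<gamma> \<delta> .
  fix x0 :: 'a
  obtain z where z: "(\<lambda>n. (f ^^ n) x0) \<longlonglongrightarrow> z"
    using Cauchy_funpow[of x0] unfolding Cauchy_convergent_iff convergent_def by blast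
  have "(\<lambda>n. (f ^^ n) z) \<longlonglongrightarrow> z"
    using z by (rule funpow_tendsto_transfer)
  then have fz: "f z = z" by (rule recurrent_imp_fixed)
  have "w = z" if "f w = w" for w
    using funpow_tendsto_fixed[OF that] funpow_tendsto_fixed[OF fz] by (rule LIMSEQ_unique)
  with fz funpow_tendsto_fixed show ?thesis by blast
qed

end
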